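(* Let $\alpha=\frac{1+\sqrt5}{2}$ and $\omega=\sqrt{\sqrt5\,\alpha}=\sqrt{2+\alpha}$. Then for any integer $s$, $$5\sum_{n=0}^\infty \frac{F_{2n+s}}{(2n+1)C_n} = 2L_{s+1} + \frac{4\sqrt5\,\pi\,\omega}{25}\big((2+2\alpha)F_s + (4-\alpha)F_{s-1}\big)$$ and $$\sum_{n=0}^\infty \frac{L_{2n+s}}{(2n+1)C_n} = 2F_{s+1} + \frac{4\sqrt5\,\pi\,\omega}{25}\left(2F_s + \alpha F_{s-1}\right).$$
   Context: $C_n=\frac{1}{n+1}\binom{2n}{n}$ ($n\ge0$) is the $n$-th Catalan number. $F_n$ and $L_n$ are the Fibonacci and Lucas numbers: $F_0=0$, $F_1=1$, $F_{n+2}=F_{n+1}+F_n$ and $L_0=2$, $L_1=1$, $L_{n+2}=L_{n+1}+L_n$, extended to negative indices by $F_{-n}=(-1)^{n+1}F_n$ and $L_{-n}=(-1)^nL_n$. *)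

theory Defs
  imports Complex_Main "HOL-Number_Theory.Fib"
begin

definition catalan :: "nat \<Rightarrow> real" where
  "catalan n = 1 / (real n + 1) * real ((2 * n) choose n)"

fun lucas :: "nat \<Rightarrow> nat" where
  "lucas 0 = 2"
| "lucas (Suc 0) = 1"
| "lucas (Suc (Suc n)) = lucas (Suc n) + lucas n"

definition fib_int :: "int \<Rightarrow> int" where
  "fib_int k = (if k \<ge> 0 then int (fib (nat k))
                else (-1) ^ (nat (- k) + 1) * int (fib (nat (- k))))"

definition lucas_int :: "int \<Rightarrow> int" where
  "lucas_int k = (if k \<ge> 0 then int (lucas (nat k))
                  else (-1) ^ nat (- k) * int (lucas (nat (- k))))"

lemma fib_int_of_nat: "fib_int (int n) = int (fib n)"
  by (simp add: fib_int_def)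

lemma lucas_int_of_nat: "lucas_int (int n) = int (lucas n)"
  by (simp add: lucas_int_def)

lemma fib_int_minus: "fib_int (- int n) = (-1) ^ (n + 1) * fib_int (int n)"
  by (cases n) (auto simp: fib_int_def nat_add_distrib)

lemma lucas_int_minus: "lucas_int (- int n) = (-1) ^ n * lucas_int (int n)"
  by (cases n) (auto simp: lucas_int_def nat_add_distrib)

end

theory Submission
  imports Defs
begin

text \<open>
  Put \<open>c\<^sub>n = 1 / ((2n + 1) C\<^sub>n)\<close>, \<open>\<alpha> = (1 + sqrt 5) / 2\<close> and \<open>\<beta> = 1 - \<alpha>\<close>. By Binet's formulas both series
  are linear combinations of \<open>S (\<alpha>\<^sup>2)\<close> and \<open>S (\<beta>\<^sup>2)\<close>, where \<open>S z\<close> is the power series \<open>\<Sum>n. c\<^sub>n z\<^sup>n\<close>; the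
  coefficients are constant multiples of \<open>\<alpha>\<^sup>s\<close> and \<open>\<beta>\<^sup>s\<close>. So it is enough to sum this power series at
  two points, both of which lie in its disc of convergence \<open>\<bar>z\<bar> < 4\<close>.

  The recurrence \<open>2 (2n + 3) c\<^sub>n\<^sub>+\<^sub>1 = (n + 2) c\<^sub>n\<close> becomes the linear differential equation
  \<open>z (4 - z) S' = 2 (z - 1) S + 2\<close>. With \<open>z = 4 sin\<^sup>2 t\<close> it has the integrating factor
  \<open>sin t cos\<^sup>3 t\<close>: the function \<open>2 sin t cos\<^sup>3 t S(4 sin\<^sup>2 t) - sin t cos t - t\<close> has derivative \<open>0\<close>
  and vanishes at \<open>t = 0\<close>. This is lemma \<open>catalan_series_sin\<close>.

  The golden ratio enters through \<open>\<alpha> = 2 sin (3 \<pi> / 10)\<close> and \<open>\<beta> = - 2 sin (\<pi> / 10)\<close>, so the two points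
  correspond to \<open>t = 3 \<pi> / 10\<close> and \<open>t = \<pi> / 10\<close>. The cosines of these angles are \<open>sqrt 5 / (2 \<omega>)\<close> and
  \<open>\<omega> / 2\<close>, which is where \<open>\<omega>\<close> comes from.
\<close>

section \<open>The power series with reciprocal Catalan coefficients\<close>

definition recip_catalan :: "nat \<Rightarrow> real" where
  "recip_catalan n = 1 / ((2 * real n + 1) * catalan n)"

lemma catalan_fact: "catalan n = fact (2 * n) / (fact n * fact (Suc n))"
  by (simp add: catalan_def binomial_fact field_simps)

lemma recip_catalan_0 [simp]: "recip_catalan 0 = 1"
  by (simp add: recip_catalan_def catalan_def)

lemma recip_catalan_Suc:
  "2 * (2 * real n + 3) * recip_catalan (Suc n) = (real n + 2) * recip_catalan n"
proof -
  have rec: "2 * ((2 * real n + 1) * catalan n) = catalan (Suc n) * (real n + 2)"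
    by (simp add: catalan_fact divide_simps) (simp add: algebra_simps)
  have "recip_catalan n = 2 / (2 * ((2 * real n + 1) * catalan n))"
    by (simp add: recip_catalan_def)
  also have "\<dots> = 2 / (catalan (Suc n) * (real n + 2))"
    by (simp only: rec)
  finally have "(real n + 2) * recip_catalan n = 2 / catalan (Suc n)"
    by (auto simp: divide_simps mult_ac)
  moreover have "(2 * real n + 3) * recip_catalan (Suc n) = 1 / catalan (Suc n)"
    by (simp add: recip_catalan_def add.commute)
  ultimately show ?thesis
    by (simp only: mult.assoc)
qed

lemma recip_catalan_pos: "recip_catalan n > 0"
  by (simp add: recip_catalan_def catalan_fact)

text \<open>The ratio of consecutive coefficients, \<open>(n + 2) / (4n + 6)\<close>, decreases to \<open>1 / 4\<close>; so for each
  \<open>\<bar>z\<bar> < 4\<close> the ratio of consecutive terms is eventually below any constant strictly between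
  \<open>\<bar>z\<bar> / 4\<close> and \<open>1\<close>.\<close>

lemma summable_recip_catalan:
  fixes z :: real
  assumes "\<bar>z\<bar> < 4"
  shows "summable (\<lambda>n. recip_catalan n * z ^ n)"
proof (rule summable_ratio_test)
  define N where "N = nat \<lceil>4 / (4 - \<bar>z\<bar>)\<rceil>"
  (* The midpoint between |z| / 4 and 1. For n >= N, so n * (4 - |z|) >= 4, the difference in the
     main estimate is at least 5 - 5 * |z| / 4 > 0. *)
  define q where "q = (4 + \<bar>z\<bar>) / 8"
  show "q < 1"
    using assms by (simp add: q_def)
  fix n assume "N \<le> n"
  hence "4 / (4 - \<bar>z\<bar>) \<le> real n"
    unfolding N_def by linarith
  hence n: "4 \<le> real n * (4 - \<bar>z\<bar>)"
    using assms by (simp add: field_simps)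
  have "\<bar>z\<bar> * (real n + 2) \<le> q * (2 * (2 * real n + 3))"
  proof -
    have "q * (2 * (2 * real n + 3)) - \<bar>z\<bar> * (real n + 2)
            = real n * (4 - \<bar>z\<bar>) / 2 + 3 - 5 * \<bar>z\<bar> / 4"
      by (simp add: q_def field_simps)
    thus ?thesis using n assms by linarith
  qed
  hence "\<bar>z\<bar> * (real n + 2) * recip_catalan n \<le> q * (2 * (2 * real n + 3)) * recip_catalan n"
    using recip_catalan_pos[of n] by (intro mult_right_mono) auto
  hence "(2 * (2 * real n + 3)) * (\<bar>z\<bar> * recip_catalan (Suc n))
           \<le> (2 * (2 * real n + 3)) * (q * recip_catalan n)"
    using recip_catalan_Suc[of n] by (simp add: mult_ac)
  hence "\<bar>z\<bar> * recip_catalan (Suc n) \<le> q * recip_catalan n"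
    by (rule mult_left_le_imp_le) simp
  hence "\<bar>z\<bar> * recip_catalan (Suc n) * \<bar>z\<bar> ^ n \<le> q * recip_catalan n * \<bar>z\<bar> ^ n"
    by (intro mult_right_mono) auto
  thus "norm (recip_catalan (Suc n) * z ^ Suc n) \<le> q * norm (recip_catalan n * z ^ n)"
    using recip_catalan_pos[of n] recip_catalan_pos[of "Suc n"]
    by (simp add: abs_mult power_abs mult_ac)
qed

definition catalan_series :: "real \<Rightarrow> real" where
  "catalan_series z = (\<Sum>n. recip_catalan n * z ^ n)"

lemma catalan_series_sums:
  "\<bar>z\<bar> < 4 \<Longrightarrow> (\<lambda>n. recip_catalan n * z ^ n) sums catalan_series z"
  unfolding catalan_series_def by (intro summable_sums summable_recip_catalan)

text \<open>Summed against \<open>z\<^sup>n\<^sup>+\<^sup>1\<close>, the coefficient recurrence turns into a first-order linear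
  differential equation.\<close>

lemma catalan_series_ode:
  assumes z: "\<bar>z\<bar> < 4"
  obtains D where "(catalan_series has_real_derivative D) (at z)"
    and "z * (4 - z) * D = 2 * (z - 1) * catalan_series z + 2"
proof
  let ?c = recip_catalan and ?S = "catalan_series z"
  let ?D = "\<Sum>n. diffs ?c n * z ^ n"
  show "(catalan_series has_real_derivative ?D) (at z)"
    using termdiffs_strong'[of 4 ?c z] summable_recip_catalan z
    by (simp add: catalan_series_def[abs_def])
  have sm: "summable (\<lambda>n. diffs ?c n * z ^ n)"
    by (rule termdiff_converges[of z 4]) (use summable_recip_catalan z in auto)
  have S: "(\<lambda>n. ?c n * z ^ n) sums ?S"
    using z by (rule catalan_series_sums)
  have "(\<lambda>n. real n * ?c n * z ^ (n - Suc 0) * z) sums (?D * z)"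
    using diffs_equiv[OF sm] by (intro sums_mult2) simp
  moreover have "real n * ?c n * z ^ (n - Suc 0) * z = real n * ?c n * z ^ n" for n
    by (cases n) auto
  ultimately have D: "(\<lambda>n. real n * ?c n * z ^ n) sums (?D * z)"
    by simp
  have "(\<lambda>n. real (Suc n) * ?c (Suc n) * z ^ Suc n) sums (?D * z)"
    using D sums_Suc_iff[of "\<lambda>n. real n * ?c n * z ^ n" "?D * z"] by simp
  moreover have "(\<lambda>n. ?c (Suc n) * z ^ Suc n) sums (?S - 1)"
    using S sums_Suc_iff[of "\<lambda>n. ?c n * z ^ n" "?S - 1"] by simp
  ultimately have "(\<lambda>n. 4 * (real (Suc n) * ?c (Suc n) * z ^ Suc n) + 2 * (?c (Suc n) * z ^ Suc n))
      sums (4 * (?D * z) + 2 * (?S - 1))"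
    by (intro sums_add sums_mult)
  moreover have "(\<lambda>n. z * (real n * ?c n * z ^ n + 2 * (?c n * z ^ n))) sums (z * (?D * z + 2 * ?S))"
    by (intro sums_add sums_mult D S)
  moreover have "4 * (real (Suc n) * ?c (Suc n) * z ^ Suc n) + 2 * (?c (Suc n) * z ^ Suc n)
      = z * (real n * ?c n * z ^ n + 2 * (?c n * z ^ n))" for n
  proof -
    have "4 * (real (Suc n) * ?c (Suc n) * z ^ Suc n) + 2 * (?c (Suc n) * z ^ Suc n)
        = z ^ Suc n * (2 * (2 * real n + 3) * ?c (Suc n))"
      by (simp add: algebra_simps)
    also have "\<dots> = z ^ Suc n * ((real n + 2) * ?c n)"
      by (simp only: recip_catalan_Suc)
    finally show ?thesis by (simp add: algebra_simps)
  qed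
  ultimately have "4 * (?D * z) + 2 * (?S - 1) = z * (?D * z + 2 * ?S)"
    by (simp add: sums_iff)
  thus "z * (4 - z) * ?D = 2 * (z - 1) * ?S + 2"
    by (simp add: algebra_simps)
qed

text \<open>The factor \<open>2 sin t cos\<^sup>3 t\<close> is an integrating factor of the differential equation in the variable
  \<open>t\<close>; since it vanishes at \<open>t = 0\<close>, the constant of integration needs no limit argument.\<close>

lemma catalan_series_sin:
  fixes t :: real
  assumes t: "0 \<le> t" "t < pi / 2"
  shows "2 * sin t * cos t ^ 3 * catalan_series (4 * sin t ^ 2) = sin t * cos t + t"
proof -
  define \<Phi> where
    "\<Phi> = (\<lambda>t. 2 * sin t * cos t ^ 3 * catalan_series (4 * sin t ^ 2) - sin t * cos t - t)"
  have deriv: "(\<Phi> has_real_derivative 0) (at x)" if "0 \<le> x" "x \<le> t" for x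
  proof -
    have "cos x > 0"
      using that t by (intro cos_gt_zero_pi) auto
    hence "sin x ^ 2 < 1"
      by (simp add: sin_squared_eq)
    hence bound: "\<bar>4 * sin x ^ 2\<bar> < 4"
      by simp
    then obtain D where D: "(catalan_series has_real_derivative D) (at (4 * sin x ^ 2))"
      and ode: "4 * sin x ^ 2 * (4 - 4 * sin x ^ 2) * D
                  = 2 * (4 * sin x ^ 2 - 1) * catalan_series (4 * sin x ^ 2) + 2"
      by (rule catalan_series_ode)
    let ?s = "sin x" and ?c = "cos x" and ?S = "catalan_series (4 * sin x ^ 2)"
    have "((\<lambda>t. catalan_series (4 * sin t ^ 2)) has_real_derivative D * (8 * ?s * ?c)) (at x)"
      by (rule DERIV_chain2[where g = "\<lambda>t. 4 * sin t ^ 2", OF D]) (auto intro!: derivative_eq_intros)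
    hence "(\<Phi> has_real_derivative
        (2 * ?c * ?c ^ 3 - 6 * ?s * ?c ^ 2 * ?s) * ?S + 2 * ?s * ?c ^ 3 * (D * (8 * ?s * ?c))
          - (?c * ?c - ?s * ?s) - 1) (at x)"
      unfolding \<Phi>_def
      by (auto intro!: derivative_eq_intros simp: algebra_simps power2_eq_square power3_eq_cube)
    moreover have "(2 * ?c * ?c ^ 3 - 6 * ?s * ?c ^ 2 * ?s) * ?S + 2 * ?s * ?c ^ 3 * (D * (8 * ?s * ?c))
          - (?c * ?c - ?s * ?s) - 1 = 0"
      using ode sin_cos_squared_add[of x] by algebra
    ultimately show ?thesis by simp
  qed
  have "\<Phi> t = \<Phi> 0"
  proof (cases "t = 0")
    case False
    show ?thesis
    proof (rule DERIV_isconst_end[where f = \<Phi>])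
      show "0 < t" using False t by simp
      show "continuous_on {0..t} \<Phi>"
        by (intro continuous_at_imp_continuous_on ballI DERIV_isCont[OF deriv]) auto
    qed (use deriv in auto)
  qed simp
  thus ?thesis by (simp add: \<Phi>_def)
qed

section \<open>Special values at the squares of the golden ratio and its conjugate\<close>

text \<open>The angle \<open>x = \<pi> / 10\<close> satisfies \<open>sin (2x) = cos (3x)\<close>. Dividing by \<open>cos x\<close> leaves a quadratic
  equation for \<open>sin x\<close>.\<close>

lemma sin_pi_tenth: "sin (pi / 10) = (sqrt 5 - 1) / 4"
proof -
  let ?x = "pi / 10"
  have c: "cos ?x > 0"
    by (intro cos_gt_zero_pi) (use pi_gt_zero in linarith)+
  have s: "sin ?x > 0"
    by (intro sin_gt_zero) (use pi_gt_zero in linarith)+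
  have "sin (2 * ?x) = cos (3 * ?x)"
    by (subst sin_cos_eq) (rule arg_cong[where f = cos], simp add: field_simps)
  hence "2 * sin ?x * cos ?x = (4 * cos ?x ^ 2 - 3) * cos ?x"
    unfolding sin_double cos_treble_cos by (simp add: algebra_simps power3_eq_cube power2_eq_square)
  hence "2 * sin ?x = 1 - 4 * sin ?x ^ 2"
    using c by (simp add: cos_squared_eq)
  hence "(4 * sin ?x + 1) ^ 2 = 5"
    by (simp add: power2_eq_square algebra_simps)
  hence "4 * sin ?x + 1 = sqrt 5"
    using s by (simp add: real_sqrt_unique)
  thus ?thesis by simp
qed

lemma sin_three_pi_tenths: "sin (3 * pi / 10) = (1 + sqrt 5) / 4"
proof -
  have "sin (3 * pi / 10) = cos (2 * (pi / 10))"
    by (subst sin_cos_eq) (rule arg_cong[where f = cos], simp add: field_simps)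
  also have "\<dots> = 1 - 2 * sin (pi / 10) ^ 2"
    by (rule cos_double_sin)
  also have "\<dots> = (1 + sqrt 5) / 4"
    unfolding sin_pi_tenth by (simp add: power2_eq_square field_simps)
  finally show ?thesis .
qed

text \<open>Since \<open>sqrt 5\<close> and \<open>\<beta>\<close> are affine in \<open>\<alpha>\<close>, all computations with these numbers take place modulo
  the quadratic relations for \<open>\<alpha>\<close> and \<open>\<omega>\<close>.\<close>

locale golden_ratio =
  fixes \<alpha> \<beta> \<omega> :: real
  assumes \<alpha>_def: "\<alpha> = (1 + sqrt 5) / 2"
    and \<beta>_def: "\<beta> = 1 - \<alpha>"
    and \<omega>_def: "\<omega> = sqrt (sqrt 5 * \<alpha>)"
begin

lemma sqrt5: "sqrt 5 = 2 * \<alpha> - 1"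
  by (simp add: \<alpha>_def field_simps)

lemma \<alpha>_square: "\<alpha>\<^sup>2 = \<alpha> + 1"
  by (simp add: \<alpha>_def power2_eq_square field_simps)

lemma \<alpha>_gt_1: "\<alpha> > 1"
  by (simp add: \<alpha>_def)

lemma \<omega>_pos: "\<omega> > 0"
  using \<alpha>_gt_1 by (simp add: \<omega>_def)

lemma sqrt5_times_\<alpha>: "sqrt 5 * \<alpha> = 2 + \<alpha>"
  unfolding sqrt5 using \<alpha>_square by (simp add: power2_eq_square algebra_simps)

lemma \<omega>_square: "\<omega>\<^sup>2 = 2 + \<alpha>"
  using \<alpha>_gt_1 by (simp add: \<omega>_def sqrt5_times_\<alpha>)

lemma \<alpha>_less_2: "\<alpha> < 2"
proof -
  have "sqrt 5 < sqrt (3\<^sup>2)"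
    by (subst real_sqrt_less_iff) simp
  thus ?thesis by (simp add: \<alpha>_def)
qed

lemma \<beta>_square: "\<beta>\<^sup>2 = 2 - \<alpha>"
  using \<alpha>_square by (simp add: \<beta>_def power2_eq_square algebra_simps)

lemma squares_in_disc: "\<bar>\<alpha>\<^sup>2\<bar> < 4" "\<bar>\<beta>\<^sup>2\<bar> < 4"
  using \<alpha>_gt_1 \<alpha>_less_2 by (simp_all add: \<alpha>_square \<beta>_square)

text \<open>Here \<open>z = \<alpha>\<^sup>2\<close> means \<open>sin t = \<alpha> / 2\<close>, and \<open>4 cos\<^sup>2 t = 3 - \<alpha> = 5 / \<omega>\<^sup>2\<close> because
  \<open>(3 - \<alpha>) (2 + \<alpha>) = 5\<close>. Only the first power of \<open>\<omega>\<close> remains in the value since \<open>\<omega>\<^sup>2\<close> lies in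
  \<open>\<rat>(sqrt 5)\<close>; this also holds for the second value, where \<open>4 cos\<^sup>2 t = \<omega>\<^sup>2\<close>.\<close>

lemma catalan_series_\<alpha>_square:
  "catalan_series (\<alpha>\<^sup>2) = 2 * sqrt 5 * \<alpha> / 5 + 12 * pi * \<omega> / 25"
proof -
  define c S where "c = cos (3 * pi / 10)" and "S = catalan_series (\<alpha>\<^sup>2)"
  have s: "sin (3 * pi / 10) = \<alpha> / 2"
    by (simp add: sin_three_pi_tenths \<alpha>_def)
  have c_pos: "c > 0"
    unfolding c_def by (intro cos_gt_zero_pi) (use pi_gt_zero in linarith)+
  have c_square: "4 * c\<^sup>2 = 3 - \<alpha>"
    by (simp add: c_def cos_squared_eq s power_divide \<alpha>_square) (simp add: field_simps)
  have "(c * (2 * \<omega>))\<^sup>2 = 5"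
    using c_square \<omega>_square \<alpha>_square by algebra
  hence c_\<omega>: "2 * c * \<omega> = sqrt 5"
    using c_pos \<omega>_pos by (simp add: real_sqrt_unique mult_ac)
  have "2 * (\<alpha> / 2) * c ^ 3 * catalan_series (4 * (\<alpha> / 2)\<^sup>2) = \<alpha> / 2 * c + 3 * pi / 10"
    unfolding c_def s[symmetric] by (rule catalan_series_sin) simp_all
  hence "10 * (\<alpha> * c ^ 3 * S) = 5 * \<alpha> * c + 3 * pi"
    by (simp add: S_def power_divide)
  hence "\<alpha> * c ^ 3 * (25 * S) = \<alpha> * c ^ 3 * (10 * sqrt 5 * \<alpha> + 12 * pi * \<omega>)"
    using c_square c_\<omega> sqrt5 \<alpha>_square by algebra
  hence "25 * S = 10 * sqrt 5 * \<alpha> + 12 * pi * \<omega>"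
    using c_pos \<alpha>_gt_1 by simp
  thus ?thesis by (simp add: S_def)
qed

lemma catalan_series_\<beta>_square:
  "catalan_series (\<beta>\<^sup>2) = 2 * sqrt 5 * (\<alpha> - 1) / 5 + 4 * pi * \<omega> * (\<alpha> - 1) / 25"
proof -
  define S where "S = catalan_series (\<beta>\<^sup>2)"
  have s: "sin (pi / 10) = (\<alpha> - 1) / 2"
    by (simp add: sin_pi_tenth \<alpha>_def field_simps)
  have c_pos: "cos (pi / 10) > 0"
    by (intro cos_gt_zero_pi) (use pi_gt_zero in linarith)+
  have "(cos (pi / 10))\<^sup>2 = (\<omega> / 2)\<^sup>2"
    by (simp add: cos_squared_eq s power_divide \<omega>_square power2_diff \<alpha>_square) (simp add: field_simps)
  hence c: "cos (pi / 10) = \<omega> / 2"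
    by (rule power2_eq_imp_eq) (use c_pos \<omega>_pos in simp_all)
  have "2 * ((\<alpha> - 1) / 2) * (\<omega> / 2) ^ 3 * catalan_series (4 * ((\<alpha> - 1) / 2)\<^sup>2)
          = (\<alpha> - 1) / 2 * (\<omega> / 2) + pi / 10"
    unfolding c[symmetric] s[symmetric] by (rule catalan_series_sin) simp_all
  hence "5 * ((\<alpha> - 1) * \<omega> ^ 3 * S) = 10 * (\<alpha> - 1) * \<omega> + 4 * pi"
    by (simp add: S_def \<beta>_def power_divide power2_commute[of 1])
      (simp add: algebra_simps)
  hence "(\<alpha> - 1) * \<omega> ^ 3 * (25 * S)
           = (\<alpha> - 1) * \<omega> ^ 3 * (10 * sqrt 5 * (\<alpha> - 1) + 4 * pi * \<omega> * (\<alpha> - 1))"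
    using \<omega>_square sqrt5 \<alpha>_square by algebra
  hence "25 * S = 10 * sqrt 5 * (\<alpha> - 1) + 4 * pi * \<omega> * (\<alpha> - 1)"
    using \<omega>_pos \<alpha>_gt_1 by simp
  thus ?thesis by (simp add: S_def)
qed

section \<open>Binet's formulas for integer indices\<close>

lemma \<beta>_eq: "\<beta> = (1 - sqrt 5) / 2"
  by (simp add: \<beta>_def \<alpha>_def field_simps)

lemma \<alpha>_times_\<beta>: "\<alpha> * \<beta> = - 1"
  using \<alpha>_square by (simp add: \<beta>_def algebra_simps power2_eq_square)

lemma \<alpha>_\<beta>_nonzero [simp]: "\<alpha> \<noteq> 0" "\<beta> \<noteq> 0"
  using \<alpha>_times_\<beta> by auto

lemma lucas_closed_form: "real (lucas n) = \<alpha> ^ n + \<beta> ^ n"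
proof (induction n rule: lucas.induct)
  case (3 n)
  have "\<beta>\<^sup>2 = \<beta> + 1"
    using \<beta>_square \<beta>_def by linarith
  with \<alpha>_square have "\<alpha> ^ Suc (Suc n) = \<alpha> ^ Suc n + \<alpha> ^ n" "\<beta> ^ Suc (Suc n) = \<beta> ^ Suc n + \<beta> ^ n"
    by (simp_all add: power2_eq_square algebra_simps flip: mult.assoc distrib_left)
  with 3 show ?case by simp
qed (simp_all add: \<beta>_def)

lemma inverse_\<alpha>_\<beta>: "inverse \<alpha> = - \<beta>" "inverse \<beta> = - \<alpha>"
  using \<alpha>_times_\<beta> by (auto intro!: inverse_unique simp: mult.commute)

lemma powi_minus: "\<alpha> powi (- int n) = (-1) ^ n * \<beta> ^ n" "\<beta> powi (- int n) = (-1) ^ n * \<alpha> ^ n"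
  by (simp_all add: power_int_minus inverse_\<alpha>_\<beta> power_minus[of \<alpha>] power_minus[of \<beta>]
      flip: power_inverse)

lemma fib_int_closed_form: "real_of_int (fib_int k) = (\<alpha> powi k - \<beta> powi k) / sqrt 5"
proof -
  have binet: "real (fib n) = (\<alpha> ^ n - \<beta> ^ n) / sqrt 5" for n
    using fib_closed_form[of n] by (simp add: \<beta>_eq \<alpha>_def)
  show ?thesis
  proof (cases k rule: int_cases2)
    case (nonneg n)
    thus ?thesis by (simp add: fib_int_of_nat binet)
  next
    case (nonpos n)
    thus ?thesis
      by (simp add: fib_int_minus fib_int_of_nat binet powi_minus) (simp add: field_simps)
  qed
qed

lemma lucas_int_closed_form: "real_of_int (lucas_int k) = \<alpha> powi k + \<beta> powi k"
proof (cases k rule: int_cases2)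
  case (nonneg n)
  thus ?thesis by (simp add: lucas_int_of_nat lucas_closed_form)
next
  case (nonpos n)
  thus ?thesis
    by (simp add: lucas_int_minus lucas_int_of_nat lucas_closed_form powi_minus algebra_simps)
qed

section \<open>The two series\<close>

lemma powi_even_shift_sums:
  assumes "\<bar>x\<^sup>2\<bar> < 4" "x \<noteq> 0"
  shows "(\<lambda>n. x powi (2 * int n + s) / ((2 * real n + 1) * catalan n))
           sums (x powi s * catalan_series (x\<^sup>2))"
proof -
  have "x powi (2 * int n) = (x\<^sup>2) ^ n" for n
    using power_int_of_nat[of x "2 * n"] by (simp only: of_nat_mult of_nat_numeral power_mult)
  hence "x powi (2 * int n + s) = x powi s * (x\<^sup>2) ^ n" for n
    using assms(2) by (simp add: power_int_add mult.commute)
  thus ?thesis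
    using sums_mult[OF catalan_series_sums[OF assms(1)], of "x powi s"]
    by (simp add: recip_catalan_def)
qed

lemma fib_series_sums:
  "(\<lambda>n. real_of_int (fib_int (2 * int n + s)) / ((2 * real n + 1) * catalan n))
     sums ((\<alpha> powi s * catalan_series (\<alpha>\<^sup>2) - \<beta> powi s * catalan_series (\<beta>\<^sup>2)) / sqrt 5)"
proof -
  have "(\<lambda>n. (\<alpha> powi (2 * int n + s) / ((2 * real n + 1) * catalan n)
               - \<beta> powi (2 * int n + s) / ((2 * real n + 1) * catalan n)) / sqrt 5)
     sums ((\<alpha> powi s * catalan_series (\<alpha>\<^sup>2) - \<beta> powi s * catalan_series (\<beta>\<^sup>2)) / sqrt 5)"
    by (intro sums_divide sums_diff powi_even_shift_sums squares_in_disc \<alpha>_\<beta>_nonzero)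
  thus ?thesis
    by (simp add: fib_int_closed_form diff_divide_distrib mult.commute)
qed

lemma lucas_series_sums:
  "(\<lambda>n. real_of_int (lucas_int (2 * int n + s)) / ((2 * real n + 1) * catalan n))
     sums (\<alpha> powi s * catalan_series (\<alpha>\<^sup>2) + \<beta> powi s * catalan_series (\<beta>\<^sup>2))"
proof -
  have "(\<lambda>n. \<alpha> powi (2 * int n + s) / ((2 * real n + 1) * catalan n)
               + \<beta> powi (2 * int n + s) / ((2 * real n + 1) * catalan n))
     sums (\<alpha> powi s * catalan_series (\<alpha>\<^sup>2) + \<beta> powi s * catalan_series (\<beta>\<^sup>2))"
    by (intro sums_add powi_even_shift_sums squares_in_disc \<alpha>_\<beta>_nonzero)
  thus ?thesis
    by (simp add: lucas_int_closed_form add_divide_distrib)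
qed

lemma powi_shifts:
  "\<alpha> powi (s + 1) = \<alpha> powi s * \<alpha>" "\<beta> powi (s + 1) = \<beta> powi s * \<beta>"
  "\<alpha> powi (s - 1) = - (\<alpha> powi s * \<beta>)" "\<beta> powi (s - 1) = - (\<beta> powi s * \<alpha>)"
  by (simp_all add: power_int_add power_int_diff divide_inverse inverse_\<alpha>_\<beta>)

text \<open>By Binet's formulas both sides are linear in \<open>p = \<alpha>\<^sup>s\<close> and \<open>q = \<beta>\<^sup>s\<close>, with coefficients of the
  form \<open>a + b \<pi> \<omega>\<close> where \<open>a\<close> and \<open>b\<close> lie in \<open>\<rat>(sqrt 5)\<close>. With \<open>u\<close> for \<open>1 / sqrt 5\<close> the claim is a
  polynomial identity modulo the relations \<open>\<alpha>\<^sup>2 = \<alpha> + 1\<close>, \<open>sqrt 5 = 2 \<alpha> - 1\<close> and \<open>u sqrt 5 = 1\<close>, in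
  which \<open>p\<close>, \<open>q\<close>, \<open>\<pi>\<close> and \<open>\<omega>\<close> are indeterminates.\<close>

lemma fib_series_value:
  "5 * ((\<alpha> powi s * catalan_series (\<alpha>\<^sup>2) - \<beta> powi s * catalan_series (\<beta>\<^sup>2)) / sqrt 5)
     = 2 * real_of_int (lucas_int (s + 1))
       + 4 * sqrt 5 * pi * \<omega> / 25
         * ((2 + 2 * \<alpha>) * real_of_int (fib_int s) + (4 - \<alpha>) * real_of_int (fib_int (s - 1)))"
proof -
  define p q u where "p = \<alpha> powi s" and "q = \<beta> powi s" and "u = inverse (sqrt 5)"
  define A B K where "A = catalan_series (\<alpha>\<^sup>2)" and "B = catalan_series (\<beta>\<^sup>2)"
    and "K = 4 * sqrt 5 * pi * \<omega> / 25"
  have "25 * A = 10 * sqrt 5 * \<alpha> + 12 * pi * \<omega>"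
    "25 * B = 10 * sqrt 5 * (\<alpha> - 1) + 4 * pi * \<omega> * (\<alpha> - 1)"
    by (simp_all add: A_def B_def catalan_series_\<alpha>_square catalan_series_\<beta>_square)
  moreover have "25 * K = 4 * sqrt 5 * pi * \<omega>" "u * sqrt 5 = 1"
    by (simp_all add: K_def u_def)
  ultimately have "5 * ((p * A - q * B) * u) = 2 * (p * \<alpha> + q * \<beta>)
      + K * ((2 + 2 * \<alpha>) * ((p - q) * u) + (4 - \<alpha>) * ((q * \<alpha> - p * \<beta>) * u))"
    using sqrt5 \<alpha>_square \<beta>_def by algebra
  thus ?thesis
    by (simp add: fib_int_closed_form lucas_int_closed_form powi_shifts divide_inverse[of _ "sqrt 5"]
        flip: p_def q_def u_def A_def B_def K_def)
qed

lemma lucas_series_value: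
  "\<alpha> powi s * catalan_series (\<alpha>\<^sup>2) + \<beta> powi s * catalan_series (\<beta>\<^sup>2)
     = 2 * real_of_int (fib_int (s + 1))
       + 4 * sqrt 5 * pi * \<omega> / 25
         * (2 * real_of_int (fib_int s) + \<alpha> * real_of_int (fib_int (s - 1)))"
proof -
  define p q u where "p = \<alpha> powi s" and "q = \<beta> powi s" and "u = inverse (sqrt 5)"
  define A B K where "A = catalan_series (\<alpha>\<^sup>2)" and "B = catalan_series (\<beta>\<^sup>2)"
    and "K = 4 * sqrt 5 * pi * \<omega> / 25"
  have "25 * A = 10 * sqrt 5 * \<alpha> + 12 * pi * \<omega>"
    "25 * B = 10 * sqrt 5 * (\<alpha> - 1) + 4 * pi * \<omega> * (\<alpha> - 1)"
    by (simp_all add: A_def B_def catalan_series_\<alpha>_square catalan_series_\<beta>_square)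
  moreover have "25 * K = 4 * sqrt 5 * pi * \<omega>" "u * sqrt 5 = 1"
    by (simp_all add: K_def u_def)
  ultimately have "p * A + q * B = 2 * ((p * \<alpha> - q * \<beta>) * u)
      + K * (2 * ((p - q) * u) + \<alpha> * ((q * \<alpha> - p * \<beta>) * u))"
    using sqrt5 \<alpha>_square \<beta>_def by algebra
  thus ?thesis
    by (simp add: fib_int_closed_form lucas_int_closed_form powi_shifts divide_inverse[of _ "sqrt 5"]
        flip: p_def q_def u_def A_def B_def K_def)
qed

end

theorem theorem1:
  fixes \<alpha> \<omega> :: real and s :: int
  assumes "\<alpha> = (1 + sqrt 5) / 2"
    and "\<omega> = sqrt (sqrt 5 * \<alpha>)"
  shows "\<omega> = sqrt (2 + \<alpha>)
    \<and> summable (\<lambda>n::nat. real_of_int (fib_int (2 * int n + s)) / ((2 * real n + 1) * catalan n))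
    \<and> 5 * (\<Sum>n::nat. real_of_int (fib_int (2 * int n + s)) / ((2 * real n + 1) * catalan n))
           = 2 * real_of_int (lucas_int (s + 1))
             + 4 * sqrt 5 * pi * \<omega> / 25
               * ((2 + 2 * \<alpha>) * real_of_int (fib_int s) + (4 - \<alpha>) * real_of_int (fib_int (s - 1)))
    \<and> summable (\<lambda>n::nat. real_of_int (lucas_int (2 * int n + s)) / ((2 * real n + 1) * catalan n))
    \<and> (\<Sum>n::nat. real_of_int (lucas_int (2 * int n + s)) / ((2 * real n + 1) * catalan n))
           = 2 * real_of_int (fib_int (s + 1))
             + 4 * sqrt 5 * pi * \<omega> / 25
               * (2 * real_of_int (fib_int s) + \<alpha> * real_of_int (fib_int (s - 1)))"
proof -
  interpret golden_ratio \<alpha> "1 - \<alpha>" \<omega>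
    using assms by unfold_locales simp_all
  have "\<omega> = sqrt (2 + \<alpha>)"
    by (simp add: assms(2) sqrt5_times_\<alpha>)
  thus ?thesis
    using sums_summable[OF fib_series_sums[of s]] sums_unique[OF fib_series_sums[of s]]
      sums_summable[OF lucas_series_sums[of s]] sums_unique[OF lucas_series_sums[of s]]
      fib_series_value[of s] lucas_series_value[of s]
    by metis
qed

end
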